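(* Let $\varOmega\subset\mathbb{R}^d$ be an open set with finite Lebesgue measure $M>0$, let $K\subset\mathbb{R}^l$ be compact, and let $u\colon\varOmega\to K$ be a Borel function. Let $\nu^u=(\nu^u_x)_{x\in\varOmega}$ be a quasi-Young measure associated with $u$. Then $\nu^u$, regarded as the mapping $\varOmega\ni x\mapsto \nu^u_x\in \mathrm{rca}(K)$, is constant.
   Context: $\mu$ denotes the normalized Lebesgue measure on $\varOmega$, $d\mu(x)=\frac1M\,dx$. $\mathrm{rca}(K)$ denotes the Banach space of regular, countably additive scalar (real-valued) Borel measures on $K$ with the total variation norm. A family $(\nu_x)_{x\in\varOmega}$ of elements of $\mathrm{rca}(K)$ is called a quasi-Young measure associated with a measurable function $u\colon\varOmega\to K$ if for every $x\in\varOmega$ and every integrable function $\beta\colon K\to\mathbb{R}$, $$\int_K\beta(k)\,d\nu_x(k)=\int_{\varOmega}\beta(u(y))\,d\mu(y).$$ Here "integrable" means: $\beta$ is Borel, $\beta$ is integrable with respect to $|\nu_x|$ for every $x\in\varOmega$, and $\beta\circ u$ is $\mu$-integrable. In particular all continuous functions and all bounded Borel functions on $K$ are allowed. *)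

theory Defs
  imports "HOL-Analysis.Analysis"
begin

text \<open>
  Real-valued measures are represented as set functions \<open>'a set \<Rightarrow> real\<close> on the
  \<open>\<sigma>\<close>-algebra of a library measure \<open>M\<close>; only \<open>space M\<close> and \<open>sets M\<close> are used below, never
  \<open>emeasure M\<close>.
\<close>

definition signed_measure :: "'a measure \<Rightarrow> ('a set \<Rightarrow> real) \<Rightarrow> bool" where
  "signed_measure M \<nu> \<longleftrightarrow>
     (\<forall>A. range A \<subseteq> sets M \<longrightarrow> disjoint_family A \<longrightarrow>
        (\<lambda>n::nat. \<nu> (A n)) sums \<nu> (\<Union>n. A n))"

definition total_variation :: "'a measure \<Rightarrow> ('a set \<Rightarrow> real) \<Rightarrow> 'a set \<Rightarrow> ennreal" where
  "total_variation M \<nu> A =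
     (SUP P \<in> {P. finite P \<and> P \<subseteq> sets M \<and> partition_on A P}. \<Sum>B\<in>P. ennreal \<bar>\<nu> B\<bar>)"

text \<open>
  The truncation of negative values by \<^const>\<open>ennreal\<close> does not affect the supremum, since
  \<open>B = {}\<close> contributes \<open>0\<close>.
\<close>

definition upper_variation :: "'a measure \<Rightarrow> ('a set \<Rightarrow> real) \<Rightarrow> 'a set \<Rightarrow> ennreal" where
  "upper_variation M \<nu> A = (SUP B \<in> {B \<in> sets M. B \<subseteq> A}. ennreal (\<nu> B))"

text \<open>
  \<open>|\<nu>|\<close> and the Jordan decomposition \<open>\<nu> = \<nu>\<^sup>+ - \<nu>\<^sup>-\<close>. As \<^const>\<open>measure_of\<close> yields the null
  measure if the given set function is not countably additive, the lemmas
  \<open>emeasure_variation_measure\<close>, \<open>emeasure_pos_part\<close> and \<open>emeasure_neg_part\<close> below show that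
  this never happens for a signed measure.
\<close>

definition variation_measure :: "'a measure \<Rightarrow> ('a set \<Rightarrow> real) \<Rightarrow> 'a measure" where
  "variation_measure M \<nu> = measure_of (space M) (sets M) (total_variation M \<nu>)"

definition pos_part :: "'a measure \<Rightarrow> ('a set \<Rightarrow> real) \<Rightarrow> 'a measure" where
  "pos_part M \<nu> = measure_of (space M) (sets M) (upper_variation M \<nu>)"

definition neg_part :: "'a measure \<Rightarrow> ('a set \<Rightarrow> real) \<Rightarrow> 'a measure" where
  "neg_part M \<nu> = pos_part M (\<lambda>B. - \<nu> B)"

definition signed_integral :: "'a measure \<Rightarrow> ('a set \<Rightarrow> real) \<Rightarrow> ('a \<Rightarrow> real) \<Rightarrow> real" where
  "signed_integral M \<nu> f = (\<integral>x. f x \<partial>pos_part M \<nu>) - (\<integral>x. f x \<partial>neg_part M \<nu>)"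

definition regular_on :: "'a::topological_space set \<Rightarrow> ('a set \<Rightarrow> real) \<Rightarrow> bool" where
  "regular_on K \<nu> \<longleftrightarrow>
     (\<forall>A \<in> sets (restrict_space borel K). \<forall>\<epsilon>>0. \<exists>F G.
        closedin (top_of_set K) F \<and> openin (top_of_set K) G \<and> F \<subseteq> A \<and> A \<subseteq> G \<and>
        total_variation (restrict_space borel K) \<nu> (G - F) < ennreal \<epsilon>)"

text \<open>
  Elements of \<open>rca(K)\<close> take the dummy value \<open>0\<close> off the Borel subsets of \<open>K\<close>. This makes
  equality of set functions coincide with equality in \<open>rca(K)\<close>, and makes the vector space
  operations pointwise.
\<close>

definition rca :: "'a::topological_space set \<Rightarrow> ('a set \<Rightarrow> real) set" where
  "rca K = {\<nu>. signed_measure (restrict_space borel K) \<nu> \<and> regular_on K \<nu> \<and>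
                (\<forall>A. A \<notin> sets (restrict_space borel K) \<longrightarrow> \<nu> A = 0)}"

definition normalized_lebesgue :: "'a::euclidean_space set \<Rightarrow> 'a measure" where
  "normalized_lebesgue \<Omega> = density (lebesgue_on \<Omega>) (\<lambda>_. ennreal (1 / measure lebesgue \<Omega>))"

definition test_function ::
  "'a::euclidean_space set \<Rightarrow> 'b::topological_space set \<Rightarrow> ('a \<Rightarrow> 'b) \<Rightarrow>
     ('a \<Rightarrow> 'b set \<Rightarrow> real) \<Rightarrow> ('b \<Rightarrow> real) \<Rightarrow> bool" where
  "test_function \<Omega> K u \<nu> \<beta> \<longleftrightarrow>
     \<beta> \<in> borel_measurable (restrict_space borel K) \<and>
     (\<forall>x\<in>\<Omega>. integrable (variation_measure (restrict_space borel K) (\<nu> x)) \<beta>) \<and>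
     integrable (normalized_lebesgue \<Omega>) (\<lambda>y. \<beta> (u y))"

definition quasi_young_measure ::
  "'a::euclidean_space set \<Rightarrow> 'b::topological_space set \<Rightarrow> ('a \<Rightarrow> 'b) \<Rightarrow>
     ('a \<Rightarrow> 'b set \<Rightarrow> real) \<Rightarrow> bool" where
  "quasi_young_measure \<Omega> K u \<nu> \<longleftrightarrow>
     u \<in> lebesgue_on \<Omega> \<rightarrow>\<^sub>M restrict_space borel K \<and>
     (\<forall>x\<in>\<Omega>. \<nu> x \<in> rca K) \<and>
     (\<forall>x\<in>\<Omega>. \<forall>\<beta>. test_function \<Omega> K u \<nu> \<beta> \<longrightarrow>
        signed_integral (restrict_space borel K) (\<nu> x) \<beta>
          = (\<integral>y. \<beta> (u y) \<partial>normalized_lebesgue \<Omega>))"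


lemma signed_measure_empty:
  assumes "signed_measure M \<nu>"
  shows "\<nu> {} = 0"
proof -
  have "(\<lambda>n::nat. \<nu> {}) sums \<nu> (\<Union>n::nat. {})"
    using assms unfolding signed_measure_def
    by (elim allE[of _ "\<lambda>_. {}"]) (auto simp: disjoint_family_on_def)
  then show ?thesis
    using sums_summable summable_const_iff by blast
qed

lemma signed_measure_Un:
  assumes "signed_measure M \<nu>" "A \<in> sets M" "B \<in> sets M" "A \<inter> B = {}"
  shows "\<nu> (A \<union> B) = \<nu> A + \<nu> B"
proof -
  have "(\<lambda>n. \<nu> (binaryset A B n)) sums \<nu> (\<Union>n. binaryset A B n)"
    using assms unfolding signed_measure_def
    by (elim allE[of _ "binaryset A B"])
       (auto simp: range_binaryset_eq disjoint_family_on_def binaryset_def split: if_splits)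
  moreover have "(\<lambda>n. \<nu> (binaryset A B n)) sums (\<nu> A + \<nu> B)"
    by (rule binaryset_sums) (rule signed_measure_empty[OF assms(1)])
  ultimately show ?thesis
    by (metis UN_binaryset_eq sums_unique2)
qed

lemma signed_measure_Union:
  assumes "signed_measure M \<nu>" "finite P" "P \<subseteq> sets M" "disjoint P"
  shows "(\<Sum>B\<in>P. \<nu> B) = \<nu> (\<Union>P)"
  using assms(2-4)
proof (induction P rule: finite_induct)
  case empty
  then show ?case by (simp add: signed_measure_empty[OF assms(1)])
next
  case (insert B P)
  have "disjoint P" "B \<inter> \<Union>P = {}"
    using insert.prems insert.hyps by (auto simp: disjoint_def)
  moreover have "\<Union>P \<in> sets M"
    using insert by (intro sets.finite_Union) auto
  ultimately show ?case
    using insert signed_measure_Un[OF assms(1), of B "\<Union>P"] by simp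
qed

lemma signed_measure_uminus:
  "signed_measure M \<nu> \<Longrightarrow> signed_measure M (\<lambda>B. - \<nu> B)"
  by (auto simp: signed_measure_def intro: sums_minus)

lemma upper_variation_upper:
  "B \<in> sets M \<Longrightarrow> B \<subseteq> A \<Longrightarrow> ennreal (\<nu> B) \<le> upper_variation M \<nu> A"
  unfolding upper_variation_def by (rule SUP_upper) auto

lemma upper_variation_mono:
  "A \<subseteq> B \<Longrightarrow> upper_variation M \<nu> A \<le> upper_variation M \<nu> B"
  unfolding upper_variation_def by (rule SUP_subset_mono) auto

lemma upper_variation_empty:
  "signed_measure M \<nu> \<Longrightarrow> upper_variation M \<nu> {} = 0"
  by (auto simp: upper_variation_def signed_measure_empty intro!: antisym SUP_least)

lemma ennreal_SUP_add_SUP_le: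
  fixes f :: "'i \<Rightarrow> ennreal" and g :: "'j \<Rightarrow> ennreal"
  assumes "I \<noteq> {}" "J \<noteq> {}" "\<And>i j. i \<in> I \<Longrightarrow> j \<in> J \<Longrightarrow> f i + g j \<le> c"
  shows "(SUP i\<in>I. f i) + (SUP j\<in>J. g j) \<le> c"
proof -
  have "f i + (SUP j\<in>J. g j) \<le> c" if "i \<in> I" for i
    using that assms(3)
    by (subst ennreal_SUP_add_right[where c = "f i", OF assms(2)])
       (intro SUP_least)
  then show ?thesis
    unfolding ennreal_SUP_add_left[OF assms(1), symmetric] by (intro SUP_least)
qed

lemma upper_variation_superadditive:
  assumes "signed_measure M \<nu>" "A \<inter> B = {}"
  shows "upper_variation M \<nu> A + upper_variation M \<nu> B \<le> upper_variation M \<nu> (A \<union> B)"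
  unfolding upper_variation_def[of _ _ A] upper_variation_def[of _ _ B]
proof (rule ennreal_SUP_add_SUP_le; clarsimp?)
  fix C D assume *: "C \<in> sets M" "C \<subseteq> A" "D \<in> sets M" "D \<subseteq> B"
  have C: "ennreal (\<nu> C) \<le> upper_variation M \<nu> (A \<union> B)"
    and D: "ennreal (\<nu> D) \<le> upper_variation M \<nu> (A \<union> B)"
    using * by (auto intro!: upper_variation_upper)
  show "ennreal (\<nu> C) + ennreal (\<nu> D) \<le> upper_variation M \<nu> (A \<union> B)"
  proof (cases "0 \<le> \<nu> C \<and> 0 \<le> \<nu> D")
    case True
    have "ennreal (\<nu> C) + ennreal (\<nu> D) = ennreal (\<nu> (C \<union> D))"
      using True * assms by (subst signed_measure_Un[of M]) auto
    also have "\<dots> \<le> upper_variation M \<nu> (A \<union> B)"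
      using * by (intro upper_variation_upper) auto
    finally show ?thesis .
  next
    case False
    then show ?thesis using C D by (auto simp: ennreal_neg)
  qed
qed auto

lemma countably_additive_upper_variation:
  assumes "signed_measure M \<nu>"
  shows "countably_additive (sets M) (upper_variation M \<nu>)"
proof (rule countably_additiveI)
  fix A :: "nat \<Rightarrow> _"
  assume A: "range A \<subseteq> sets M" "disjoint_family A" "(\<Union>i. A i) \<in> sets M"
  show "(\<Sum>i. upper_variation M \<nu> (A i)) = upper_variation M \<nu> (\<Union>i. A i)"
  proof (rule antisym)
    have "(\<Sum>i<n. upper_variation M \<nu> (A i)) \<le> upper_variation M \<nu> (\<Union>i<n. A i)" for n
    proof (induction n)
      case 0
      then show ?case by simp
    next
      case (Suc n)
      have "A i \<inter> A n = {}" if "i < n" for i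
        using A(2) that by (intro disjoint_family_onD) auto
      then have "(\<Union>i<n. A i) \<inter> A n = {}"
        by blast
      then have "upper_variation M \<nu> (\<Union>i<n. A i) + upper_variation M \<nu> (A n)
          \<le> upper_variation M \<nu> ((\<Union>i<n. A i) \<union> A n)"
        by (rule upper_variation_superadditive[OF assms])
      also have "(\<Union>i<n. A i) \<union> A n = (\<Union>i<Suc n. A i)"
        by (auto simp: lessThan_Suc)
      finally show ?case
        using add_right_mono[OF Suc] by (simp only: sum.lessThan_Suc) (rule order_trans)
    qed
    also have "upper_variation M \<nu> (\<Union>i<n. A i) \<le> upper_variation M \<nu> (\<Union>i. A i)" for n
      by (rule upper_variation_mono) auto
    finally show "(\<Sum>i. upper_variation M \<nu> (A i)) \<le> upper_variation M \<nu> (\<Union>i. A i)"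
      by (intro suminf_le_const summableI)
  next
    show "upper_variation M \<nu> (\<Union>i. A i) \<le> (\<Sum>i. upper_variation M \<nu> (A i))"
      unfolding upper_variation_def[of _ _ "\<Union>i. A i"]
    proof (rule SUP_least, clarify)
      fix B assume B: "B \<in> sets M" "B \<subseteq> (\<Union>i. A i)"
      have "(\<lambda>i. \<nu> (A i \<inter> B)) sums \<nu> (\<Union>i. A i \<inter> B)"
        using assms A B unfolding signed_measure_def
        by (elim allE[of _ "\<lambda>i. A i \<inter> B"]) (auto simp: disjoint_family_on_def)
      moreover have "(\<Union>i. A i \<inter> B) = B"
        using B by auto
      ultimately have "(\<lambda>n. \<Sum>i<n. \<nu> (A i \<inter> B)) \<longlonglongrightarrow> \<nu> B"
        by (simp add: sums_def)
      then have "(\<lambda>n. ennreal (\<Sum>i<n. \<nu> (A i \<inter> B))) \<longlonglongrightarrow> ennreal (\<nu> B)"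
        by (rule tendsto_ennrealI)
      then show "ennreal (\<nu> B) \<le> (\<Sum>i. upper_variation M \<nu> (A i))"
      proof (rule LIMSEQ_le_const2, intro exI allI impI)
        fix n :: nat
        have "ennreal (\<Sum>i<n. \<nu> (A i \<inter> B)) \<le> ennreal (\<Sum>i<n. max 0 (\<nu> (A i \<inter> B)))"
          by (intro ennreal_leI sum_mono) auto
        also have "\<dots> = (\<Sum>i<n. ennreal (max 0 (\<nu> (A i \<inter> B))))"
          by (simp add: sum_ennreal)
        also have "\<dots> \<le> (\<Sum>i<n. upper_variation M \<nu> (A i))"
          using A B by (intro sum_mono) (auto simp: max_def intro!: upper_variation_upper)
        also have "\<dots> \<le> (\<Sum>i. upper_variation M \<nu> (A i))"
          by (rule sum_le_suminf) auto
        finally show "ennreal (\<Sum>i<n. \<nu> (A i \<inter> B)) \<le> (\<Sum>i. upper_variation M \<nu> (A i))" .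
      qed
    qed
  qed
qed

lemma total_variation_upper:
  assumes "finite P" "P \<subseteq> sets M" "disjoint P" "\<Union>P = A"
  shows "(\<Sum>B\<in>P - {{}}. ennreal \<bar>\<nu> B\<bar>) \<le> total_variation M \<nu> A"
  unfolding total_variation_def
  using assms by (intro SUP_upper) (auto simp: partition_on_def disjoint_def)

lemma total_variation_ge:
  assumes "signed_measure M \<nu>" "A \<in> sets M" "C \<in> sets M" "D \<in> sets M"
    "C \<subseteq> A" "D \<subseteq> A" "C \<inter> D = {}"
  shows "ennreal (\<bar>\<nu> C\<bar> + \<bar>\<nu> D\<bar>) \<le> total_variation M \<nu> A"
proof -
  let ?P = "{C, D, A - C - D}"
  have "ennreal (\<bar>\<nu> C\<bar> + \<bar>\<nu> D\<bar>) = (\<Sum>B\<in>{C, D} - {{}}. ennreal \<bar>\<nu> B\<bar>)"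
  proof (cases "C = {} \<or> D = {}")
    case True
    then show ?thesis
      using signed_measure_empty[OF assms(1)] by (auto simp: insert_Diff_if)
  next
    case False
    then have "C \<noteq> D" using assms by auto
    with False show ?thesis by (simp add: insert_Diff_if)
  qed
  also have "\<dots> \<le> (\<Sum>B\<in>?P - {{}}. ennreal \<bar>\<nu> B\<bar>)"
    by (rule sum_mono2) auto
  also have "\<dots> \<le> total_variation M \<nu> A"
    using assms by (intro total_variation_upper) (auto simp: disjoint_def)
  finally show ?thesis .
qed

lemma total_variation_eq:
  assumes \<nu>: "signed_measure M \<nu>" and A: "A \<in> sets M"
  shows "total_variation M \<nu> A
    = upper_variation M \<nu> A + upper_variation M (\<lambda>B. - \<nu> B) A"
proof (rule antisym)
  show "total_variation M \<nu> A \<le> upper_variation M \<nu> A + upper_variation M (\<lambda>B. - \<nu> B) A"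
    unfolding total_variation_def
  proof (rule SUP_least, clarify)
    fix P assume P: "finite P" "P \<subseteq> sets M" "partition_on A P"
    define Q R where "Q = {B \<in> P. 0 \<le> \<nu> B}" and "R = {B \<in> P. \<not> 0 \<le> \<nu> B}"
    have fin: "finite Q" "finite R" and sub: "Q \<subseteq> sets M" "R \<subseteq> sets M"
      and dj: "disjoint Q" "disjoint R" and QR: "Q \<inter> R = {}" "P = Q \<union> R"
      and le: "\<Union>Q \<subseteq> A" "\<Union>R \<subseteq> A"
      using P by (auto simp: Q_def R_def partition_on_def disjoint_def)
    have "(\<Sum>B\<in>P. ennreal \<bar>\<nu> B\<bar>) = (\<Sum>B\<in>Q. ennreal \<bar>\<nu> B\<bar>) + (\<Sum>B\<in>R. ennreal \<bar>\<nu> B\<bar>)"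
      unfolding QR(2) using fin QR(1) by (rule sum.union_disjoint)
    also have "(\<Sum>B\<in>Q. ennreal \<bar>\<nu> B\<bar>) = ennreal (\<Sum>B\<in>Q. \<nu> B)"
      by (subst sum_ennreal[symmetric]) (auto simp: Q_def intro!: sum.cong)
    also have "(\<Sum>B\<in>R. ennreal \<bar>\<nu> B\<bar>) = ennreal (\<Sum>B\<in>R. - \<nu> B)"
      by (subst sum_ennreal[symmetric]) (auto simp: R_def intro!: sum.cong)
    also have "(\<Sum>B\<in>Q. \<nu> B) = \<nu> (\<Union>Q)"
      using \<nu> fin sub dj by (intro signed_measure_Union)
    also have "(\<Sum>B\<in>R. - \<nu> B) = - \<nu> (\<Union>R)"
      using signed_measure_uminus[OF \<nu>] fin sub dj by (intro signed_measure_Union)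
    also have "ennreal (\<nu> (\<Union>Q)) + ennreal (- \<nu> (\<Union>R))
        \<le> upper_variation M \<nu> A + upper_variation M (\<lambda>B. - \<nu> B) A"
      using fin sub le
      by (intro add_mono upper_variation_upper[where \<nu> = \<nu>]
            upper_variation_upper[where \<nu> = "\<lambda>B. - \<nu> B"] sets.finite_Union) auto
    finally show "(\<Sum>B\<in>P. ennreal \<bar>\<nu> B\<bar>)
        \<le> upper_variation M \<nu> A + upper_variation M (\<lambda>B. - \<nu> B) A" .
  qed
next
  show "upper_variation M \<nu> A + upper_variation M (\<lambda>B. - \<nu> B) A \<le> total_variation M \<nu> A"
    unfolding upper_variation_def
  proof (rule ennreal_SUP_add_SUP_le; clarsimp?)
    fix C D assume *: "C \<in> sets M" "C \<subseteq> A" "D \<in> sets M" "D \<subseteq> A"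
    have C: "ennreal \<bar>\<nu> C\<bar> \<le> total_variation M \<nu> A"
      using total_variation_ge[OF \<nu> A, of C "{}"] * signed_measure_empty[OF \<nu>] by simp
    have D: "ennreal \<bar>\<nu> D\<bar> \<le> total_variation M \<nu> A"
      using total_variation_ge[OF \<nu> A, of D "{}"] * signed_measure_empty[OF \<nu>] by simp
    show "ennreal (\<nu> C) + ennreal (- \<nu> D) \<le> total_variation M \<nu> A"
    proof (cases "0 \<le> \<nu> C \<and> 0 \<le> - \<nu> D")
      case True
      have "\<nu> C = \<nu> (C - D) + \<nu> (C \<inter> D)"
      proof -
        have "C - D \<union> C \<inter> D = C" by blast
        then show ?thesis
          using signed_measure_Un[OF \<nu>, of "C - D" "C \<inter> D"] * by fastforce
      qed
      moreover have "\<nu> D = \<nu> (D - C) + \<nu> (C \<inter> D)"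
      proof -
        have "D - C \<union> C \<inter> D = D" by blast
        then show ?thesis
          using signed_measure_Un[OF \<nu>, of "D - C" "C \<inter> D"] * by fastforce
      qed
      ultimately have "\<nu> C + - \<nu> D \<le> \<bar>\<nu> (C - D)\<bar> + \<bar>\<nu> (D - C)\<bar>"
        by linarith
      then have "ennreal (\<nu> C) + ennreal (- \<nu> D) \<le> ennreal (\<bar>\<nu> (C - D)\<bar> + \<bar>\<nu> (D - C)\<bar>)"
        using True ennreal_leI by (simp add: ennreal_plus[symmetric] del: ennreal_plus)
      also have "\<dots> \<le> total_variation M \<nu> A"
        using * by (intro total_variation_ge \<nu> A) auto
      finally show ?thesis .
    next
      case False
      then show ?thesis using C D by (auto simp: ennreal_neg abs_if split: if_splits)
    qed
  qed auto
qed

lemma countably_additive_total_variation: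
  assumes "signed_measure M \<nu>"
  shows "countably_additive (sets M) (total_variation M \<nu>)"
proof (rule countably_additiveI)
  fix A :: "nat \<Rightarrow> _"
  assume A: "range A \<subseteq> sets M" "disjoint_family A" "(\<Union>i. A i) \<in> sets M"
  have "(\<Sum>i. total_variation M \<nu> (A i))
      = (\<Sum>i. upper_variation M \<nu> (A i) + upper_variation M (\<lambda>B. - \<nu> B) (A i))"
    using A by (intro suminf_cong total_variation_eq[OF assms]) auto
  also have "\<dots> = (\<Sum>i. upper_variation M \<nu> (A i)) + (\<Sum>i. upper_variation M (\<lambda>B. - \<nu> B) (A i))"
    by (intro suminf_add[symmetric] summableI)
  also have "\<dots> = upper_variation M \<nu> (\<Union>i. A i) + upper_variation M (\<lambda>B. - \<nu> B) (\<Union>i. A i)"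
    using countably_additive_upper_variation[OF assms]
      countably_additive_upper_variation[OF signed_measure_uminus[OF assms]] A
    by (simp add: countably_additive_def)
  also have "\<dots> = total_variation M \<nu> (\<Union>i. A i)"
    using A(3) by (intro total_variation_eq[OF assms, symmetric])
  finally show "(\<Sum>i. total_variation M \<nu> (A i)) = total_variation M \<nu> (\<Union>i. A i)" .
qed

lemma emeasure_pos_part:
  assumes "signed_measure M \<nu>" "A \<in> sets M"
  shows "emeasure (pos_part M \<nu>) A = upper_variation M \<nu> A"
  unfolding pos_part_def
  using assms countably_additive_upper_variation upper_variation_empty
  by (intro emeasure_measure_of_sigma) (auto simp: positive_def sets.sigma_algebra_axioms)

lemma emeasure_neg_part:
  assumes "signed_measure M \<nu>" "A \<in> sets M"
  shows "emeasure (neg_part M \<nu>) A = upper_variation M (\<lambda>B. - \<nu> B) A"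
  unfolding neg_part_def by (intro emeasure_pos_part signed_measure_uminus assms)

lemma emeasure_variation_measure:
  assumes "signed_measure M \<nu>" "A \<in> sets M"
  shows "emeasure (variation_measure M \<nu>) A = total_variation M \<nu> A"
  unfolding variation_measure_def
proof (rule emeasure_measure_of_sigma)
  show "positive (sets M) (total_variation M \<nu>)"
    using assms(1)
    by (simp add: positive_def total_variation_eq upper_variation_empty signed_measure_uminus)
qed (use assms countably_additive_total_variation sets.sigma_algebra_axioms in auto)

end

theory Submission
  imports Defs
begin

text \<open>
  Indicator functions of Borel subsets of \<open>K\<close> are test functions, because a real-valued signed
  measure has finite total variation. Testing with the indicator of \<open>A\<close> gives
  \<open>\<nu>\<^sub>x(A) = \<mu>(u\<inverse>(A))\<close> by the Jordan decomposition, and the right-hand side does not depend on \<open>x\<close>.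
\<close>

lemma signed_measure_Diff:
  assumes "signed_measure M \<nu>" "A \<in> sets M" "B \<in> sets M" "B \<subseteq> A"
  shows "\<nu> (A - B) = \<nu> A - \<nu> B"
  using signed_measure_Un[OF assms(1), of "A - B" B] assms(2-4)
  by (simp add: Diff_disjoint Int_commute Un_absorb2)

lemma upper_variation_eq_top_obtains:
  assumes "upper_variation M \<nu> A = top"
  obtains B where "B \<in> sets M" "B \<subseteq> A" "c < \<nu> B"
proof -
  \<comment> \<open>Raising \<open>c\<close> to \<open>max 0 c\<close> provides the nonnegative left
    side that \<open>ennreal_less_iff\<close> requires to return to the reals.\<close>
  have "ennreal (max 0 c) < upper_variation M \<nu> A"
    using assms by simp
  then obtain B where "B \<in> sets M" "B \<subseteq> A" "ennreal (max 0 c) < ennreal (\<nu> B)"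
    unfolding upper_variation_def less_SUP_iff by auto
  then show thesis
    by (intro that[of B]) (auto simp: ennreal_less_iff)
qed

lemma sets_variation_measure [simp]: "sets (variation_measure M \<nu>) = sets M"
  by (simp add: variation_measure_def)

text \<open>Infinite variation yields \<open>C\<close> inside \<open>A\<close> with
  \<open>\<bar>\<nu> C\<bar>\<close> so large that \<open>A - C\<close> must nearly cancel it.
  Variation is additive, so \<open>C\<close> or \<open>A - C\<close> has infinite variation: that
  piece is kept as \<open>B\<close>, the other is split off.\<close>

lemma total_variation_eq_top_split:
  assumes \<nu>: "signed_measure M \<nu>" and A: "A \<in> sets M" and inf: "total_variation M \<nu> A = top"
  shows "\<exists>B. B \<in> sets M \<and> B \<subseteq> A \<and> total_variation M \<nu> B = top \<and> 1 \<le> \<bar>\<nu> (A - B)\<bar>"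
proof -
  \<comment> \<open>With this bound both \<open>\<bar>\<nu> C\<bar>\<close> and
    \<open>\<bar>\<nu> A - \<nu> C\<bar>\<close> exceed \<open>1\<close>, so either piece may be the
    one split off.\<close>
  have "\<exists>C. C \<in> sets M \<and> C \<subseteq> A \<and> \<bar>\<nu> A\<bar> + 1 < \<bar>\<nu> C\<bar>"
  proof -
    consider "upper_variation M \<nu> A = top" | "upper_variation M (\<lambda>B. - \<nu> B) A = top"
      using inf unfolding total_variation_eq[OF \<nu> A] by auto
    then show ?thesis
    proof cases
      case 1
      then show ?thesis
        by (rule upper_variation_eq_top_obtains[of _ _ _ "\<bar>\<nu> A\<bar> + 1"]) force
    next
      case 2
      then show ?thesis
        by (rule upper_variation_eq_top_obtains[of _ _ _ "\<bar>\<nu> A\<bar> + 1"]) force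
    qed
  qed
  then obtain C where C: "C \<in> sets M" "C \<subseteq> A" "\<bar>\<nu> A\<bar> + 1 < \<bar>\<nu> C\<bar>"
    by blast
  let ?D = "A - C"
  have D: "?D \<in> sets M" "\<nu> ?D = \<nu> A - \<nu> C"
    using signed_measure_Diff[OF \<nu> A] A C by auto
  have "emeasure (variation_measure M \<nu>) C + emeasure (variation_measure M \<nu>) ?D
      = emeasure (variation_measure M \<nu>) (C \<union> ?D)"
    using C D by (intro plus_emeasure) auto
  moreover have "C \<union> ?D = A"
    using C by blast
  ultimately have "total_variation M \<nu> C + total_variation M \<nu> ?D = top"
    using A C D inf by (simp add: emeasure_variation_measure[OF \<nu>])
  then consider "total_variation M \<nu> C = top" | "total_variation M \<nu> ?D = top"
    by auto
  then show ?thesis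
  proof cases
    case 1
    then show ?thesis
      using C D by (intro exI[of _ C]) auto
  next
    case 2
    moreover have "A - ?D = C"
      using C by blast
    ultimately show ?thesis
      using C D by (intro exI[of _ ?D]) auto
  qed
qed

text \<open>
  If the total variation of \<open>A\<close> were infinite, one could split off infinitely many disjoint sets of
  measure at least \<open>1\<close> in absolute value, and their measures would not be summable.
\<close>

lemma total_variation_finite:
  assumes \<nu>: "signed_measure M \<nu>" and A: "A \<in> sets M"
  shows "total_variation M \<nu> A < top"
proof (rule ccontr)
  assume "\<not> ?thesis"
  then have inf: "total_variation M \<nu> A = top"
    by (metis top.not_eq_extremum)
  define P where "P B \<longleftrightarrow> B \<in> sets M \<and> total_variation M \<nu> B = top" for B
  \<comment> \<open>Infinite variation is the invariant \<open>P\<close> that lets the splitting be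
    iterated; the successive differences of \<open>E\<close> are the pieces split off.\<close>
  have "\<exists>E. \<forall>n::nat. P (E n) \<and> (E (Suc n) \<subseteq> E n \<and> 1 \<le> \<bar>\<nu> (E n - E (Suc n))\<bar>)"
  proof (rule dependent_nat_choice[where P = "\<lambda>_. P" and Q = "\<lambda>_ B C. C \<subseteq> B \<and> 1 \<le> \<bar>\<nu> (B - C)\<bar>"])
    show "\<exists>B. P B"
      using A inf P_def by blast
    show "\<exists>C. P C \<and> C \<subseteq> B \<and> 1 \<le> \<bar>\<nu> (B - C)\<bar>" if "P B" for B
      using total_variation_eq_top_split[OF \<nu>, of B] that unfolding P_def by blast
  qed
  then obtain E where E: "\<And>n. E n \<in> sets M" "\<And>n. E (Suc n) \<subseteq> E n"
    "\<And>n. 1 \<le> \<bar>\<nu> (E n - E (Suc n))\<bar>"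
    unfolding P_def by blast
  let ?D = "\<lambda>n. E n - E (Suc n)"
  have dec: "decseq E"
    by (rule decseq_SucI) (rule E)
  \<comment> \<open>The later of two differences lies in a set that the earlier one removes.\<close>
  have "disjoint_family ?D"
    unfolding disjoint_family_on_def
  proof (intro ballI impI)
    fix m n :: nat assume "m \<noteq> n"
    then consider "Suc m \<le> n" | "Suc n \<le> m" by linarith
    then show "?D m \<inter> ?D n = {}"
    proof cases
      case 1
      then have "E n \<subseteq> E (Suc m)" by (rule decseqD[OF dec])
      then show ?thesis by blast
    next
      case 2
      then have "E m \<subseteq> E (Suc n)" by (rule decseqD[OF dec])
      then show ?thesis by blast
    qed
  qed
  moreover have "range ?D \<subseteq> sets M"
    using E(1) by auto
  ultimately have "(\<lambda>n. \<nu> (?D n)) sums \<nu> (\<Union>n. ?D n)"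
    using \<nu> unfolding signed_measure_def by (elim allE[of _ ?D]) (elim impE)
  then have "(\<lambda>n. \<nu> (?D n)) \<longlonglongrightarrow> 0"
    by (intro summable_LIMSEQ_zero) (rule sums_summable)
  then have "(\<lambda>n. \<bar>\<nu> (?D n)\<bar>) \<longlonglongrightarrow> 0"
    by (rule tendsto_rabs_zero)
  then have "(1::real) \<le> 0"
    using E(3) by (intro LIMSEQ_le_const) auto
  then show False by simp
qed

lemma upper_variation_finite:
  assumes "signed_measure M \<nu>" "A \<in> sets M"
  shows "upper_variation M \<nu> A < top"
  using total_variation_finite[OF assms]
  by (simp add: total_variation_eq[OF assms] ennreal_add_less_top)

text \<open>For \<open>B \<subseteq> A\<close>, \<open>\<nu> B = \<nu> A - \<nu> (A - B)\<close>,
  and \<open>- \<nu> (A - B)\<close> is at most the negative variation of \<open>A\<close>; the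
  supremum over \<open>B\<close> gives the bound. This is one half of the Jordan
  decomposition.\<close>

lemma upper_variation_le_uminus:
  assumes \<nu>: "signed_measure M \<nu>" and A: "A \<in> sets M"
  shows "enn2real (upper_variation M \<nu> A)
    \<le> \<nu> A + enn2real (upper_variation M (\<lambda>B. - \<nu> B) A)"
proof -
  define n where "n = enn2real (upper_variation M (\<lambda>B. - \<nu> B) A)"
  have le_n: "- \<nu> C \<le> n" if "C \<in> sets M" "C \<subseteq> A" for C
  proof -
    \<comment> \<open>Finiteness makes \<open>ennreal n\<close> equal to the negative variation; at
      \<open>top\<close>, \<open>enn2real\<close> would give \<open>0\<close>.\<close>
    have "ennreal (- \<nu> C) \<le> ennreal n"
      using upper_variation_upper[OF that, of "\<lambda>B. - \<nu> B"]
        upper_variation_finite[OF signed_measure_uminus[OF \<nu>] A]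
      by (simp add: n_def)
    then show ?thesis
      by (auto simp: n_def ennreal_le_iff)
  qed
  have "upper_variation M \<nu> A \<le> ennreal (\<nu> A + n)"
    unfolding upper_variation_def
  proof (rule SUP_least, clarify)
    fix B assume B: "B \<in> sets M" "B \<subseteq> A"
    then have "- \<nu> (A - B) \<le> n"
      using A by (intro le_n) auto
    then show "ennreal (\<nu> B) \<le> ennreal (\<nu> A + n)"
      using signed_measure_Diff[OF \<nu> A B] by (intro ennreal_leI) simp
  qed
  \<comment> \<open>The bound must be nonnegative for \<open>enn2real_leI\<close>.\<close>
  moreover have "0 \<le> \<nu> A + n"
    using le_n[of A] A by simp
  ultimately show ?thesis
    unfolding n_def[symmetric] by (intro enn2real_leI)
qed

text \<open>The preceding inequality for \<open>\<nu>\<close> and for its negative gives the two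
  directions, since negating twice returns \<open>\<nu>\<close>.\<close>

lemma jordan_decomposition:
  assumes \<nu>: "signed_measure M \<nu>" and A: "A \<in> sets M"
  shows "measure (pos_part M \<nu>) A - measure (neg_part M \<nu>) A = \<nu> A"
  using upper_variation_le_uminus[OF assms]
    upper_variation_le_uminus[OF signed_measure_uminus[OF \<nu>] A]
  by (simp add: measure_def emeasure_pos_part[OF assms] emeasure_neg_part[OF assms])

lemma signed_integral_indicator:
  assumes "signed_measure M \<nu>" "A \<in> sets M"
  shows "signed_integral M \<nu> (indicator A) = \<nu> A"
proof -
  have "A \<inter> space M = A"
    using sets.sets_into_space[OF assms(2)] by blast
  moreover have "space (pos_part M \<nu>) = space M" "space (neg_part M \<nu>) = space M"
    by (simp_all add: pos_part_def neg_part_def)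
  ultimately show ?thesis
    using jordan_decomposition[OF assms] by (simp add: signed_integral_def)
qed

lemma integrable_indicator_comp:
  assumes "finite_measure N" "u \<in> N \<rightarrow>\<^sub>M L" "A \<in> sets L"
  shows "integrable N (\<lambda>y. indicator A (u y) :: real)"
proof (rule finite_measure.integrable_const_bound[OF assms(1), of _ 1])
  show "(\<lambda>y. indicator A (u y) :: real) \<in> borel_measurable N"
    using assms(2,3) by (intro measurable_compose[OF assms(2)]) simp
qed (simp add: indicator_def)

text \<open>The total mass is a product of two finite factors. A null set is covered as well, with
  \<open>1 / 0 = 0\<close>.\<close>

lemma finite_measure_normalized_lebesgue:
  assumes "\<Omega> \<in> sets lebesgue" "emeasure lebesgue \<Omega> < top"
  shows "finite_measure (normalized_lebesgue \<Omega>)"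
proof (rule finite_measureI)
  have "emeasure (normalized_lebesgue \<Omega>) (space (normalized_lebesgue \<Omega>))
      = ennreal (1 / measure lebesgue \<Omega>) * emeasure lebesgue \<Omega>"
    using assms(1)
    by (simp add: normalized_lebesgue_def emeasure_density nn_integral_cmult_indicator
        nn_integral_const emeasure_restrict_space)
  also have "\<dots> < top"
    using assms(2) by (intro ennreal_mult_less_top[THEN iffD2]) auto
  finally show "emeasure (normalized_lebesgue \<Omega>) (space (normalized_lebesgue \<Omega>)) \<noteq> \<infinity>"
    by simp
qed

lemma test_function_indicator:
  assumes \<Omega>: "\<Omega> \<in> sets lebesgue" "emeasure lebesgue \<Omega> < top"
    and qy: "quasi_young_measure \<Omega> K u \<nu>"
    and A: "A \<in> sets (restrict_space borel K)"
  shows "test_function \<Omega> K u \<nu> (indicator A)"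
  unfolding test_function_def
proof (intro conjI ballI)
  let ?B = "restrict_space borel K"
  show "indicator A \<in> borel_measurable ?B"
    using A by simp
  show "integrable (variation_measure ?B (\<nu> x)) (indicator A :: _ \<Rightarrow> real)" if "x \<in> \<Omega>" for x
  proof -
    have "signed_measure ?B (\<nu> x)"
      using qy that by (simp add: quasi_young_measure_def rca_def)
    then show ?thesis
      using A total_variation_finite[of ?B "\<nu> x" A]
      by (intro integrable_real_indicator)
         (simp_all only: emeasure_variation_measure sets_variation_measure infinity_ennreal_def)
  qed
  \<comment> \<open>A density leaves the \<sigma>-algebra of \<open>lebesgue_on \<Omega>\<close>
    unchanged.\<close>
  have "u \<in> normalized_lebesgue \<Omega> \<rightarrow>\<^sub>M ?B"
    using qy by (simp add: quasi_young_measure_def normalized_lebesgue_def)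
  then show "integrable (normalized_lebesgue \<Omega>) (\<lambda>y. indicator A (u y) :: real)"
    using finite_measure_normalized_lebesgue[OF \<Omega>] A by (intro integrable_indicator_comp)
qed

theorem proposition3p1:
  fixes \<Omega> :: "(real ^ 'd) set" and K :: "(real ^ 'l) set" and M :: real
    and u :: "real ^ 'd \<Rightarrow> real ^ 'l"
    and \<nu> :: "real ^ 'd \<Rightarrow> (real ^ 'l) set \<Rightarrow> real"
  assumes "open \<Omega>" and "emeasure lebesgue \<Omega> = ennreal M" and "0 < M"
    and "compact K"
    and "u \<in> restrict_space borel \<Omega> \<rightarrow>\<^sub>M restrict_space borel K"
    and "quasi_young_measure \<Omega> K u \<nu>"
  shows "\<nu> constant_on \<Omega>"
proof -
  let ?B = "restrict_space borel K"
  \<comment> \<open>The right side is free of \<open>x\<close>. The branch \<open>0\<close> is the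
    dummy value prescribed by \<open>rca\<close>, so the set functions agree on all sets, not only
    on Borel ones.\<close>
  have *: "\<nu> x A = (if A \<in> sets ?B then \<integral>y. indicator A (u y) \<partial>normalized_lebesgue \<Omega> else 0)"
    if x: "x \<in> \<Omega>" for x A
  proof (cases "A \<in> sets ?B")
    case True
    have "test_function \<Omega> K u \<nu> (indicator A)"
      using assms True by (intro test_function_indicator) auto
    then have "signed_integral ?B (\<nu> x) (indicator A)
        = (\<integral>y. indicator A (u y) \<partial>normalized_lebesgue \<Omega>)"
      using assms(6) x unfolding quasi_young_measure_def by blast
    moreover have "signed_measure ?B (\<nu> x)"
      using assms(6) x by (simp add: quasi_young_measure_def rca_def)
    ultimately show ?thesis
      using True by (simp add: signed_integral_indicator)
  next
    case False
    then show ?thesis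
      using assms(6) x by (simp add: quasi_young_measure_def rca_def)
  qed
  have "\<nu> x = (\<lambda>A. if A \<in> sets ?B
      then \<integral>y. indicator A (u y) \<partial>normalized_lebesgue \<Omega> else 0)" if "x \<in> \<Omega>" for x
    by (rule ext) (rule *[OF that])
  then show ?thesis
    unfolding constant_on_def by blast
qed

end
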